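(* Let $N\ge2$, let $m_1,\dots,m_N\in\bar\Omega^*$ be distinct, and suppose the nonnegative function $g$ is bounded in $\Omega$. For $\mathbf b\in\mathbb R^N_+$ write $G_i(\mathbf b)=G_{\mathcal R(\mathbf b)}(m_i)$, and let $\mathbf e_i$ be the $i$-th standard unit vector of $\mathbb R^N$. Then for each $1\le i\le N$, $$0\le G_i(\mathbf b+t\,\mathbf e_i)-G_i(\mathbf b)\le \Big(\sup_\Omega g\Big)\sum_{r\ne i}\frac{C(\kappa,m_i\cdot m_r)}{b_r}\,(-t)$$ for all $-b_i<t<0$ and for each $\mathbf b=(b_1,\dots,b_N)\in\mathbb R^N_+$, where the constant $C(\kappa,m_i\cdot m_r)$ depends only on $\kappa$ and the angle between $m_i$ and $m_r$.
   Context: Setting: $0<\kappa<1$ is fixed. $S^2$ is the unit sphere in $\mathbb R^3$, $dx$ denotes surface measure, and $\Omega,\Omega^*\subset S^2$ are domains with $\inf_{m\in\bar\Omega^*,\,x\in\bar\Omega} m\cdot x\ge\kappa$, the boundary of $\Omega$ having surface measure zero. $g\in L^1(\bar\Omega)$ is a given nonnegative function. $\mathbb R^N_+=\{(b_1,\dots,b_N):b_j>0\text{ for all }j\}$. Semi-ellipsoids: for $m\in S^2$, $b>0$, $E(m,b)=\{\rho(x)x:\rho(x)=\frac{b}{1-\kappa m\cdot x},\ x\in S^2,\ m\cdot x\ge\kappa\}$. Refractors: a surface $\mathcal R=\{\rho(x)x:x\in\bar\Omega\}$ is a refractor from $\bar\Omega$ to $\bar\Omega^*$ if for every $x_o\in\bar\Omega$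 there are $m\in\bar\Omega^*$, $b>0$ with $\rho(x_o)=\frac{b}{1-\kappa m\cdot x_o}$ and $\rho(x)\le\frac{b}{1-\kappa m\cdot x}$ for all $x\in\bar\Omega$; then $E(m,b)$ is said to support $\mathcal R$ at $x_o$. Tracing map and refractor measure: $\mathcal T_{\mathcal R}(m)=\{x\in\bar\Omega: E(m,b)\text{ supports }\mathcal R\text{ at }x\text{ for some }b>0\}$ for $m\in\bar\Omega^*$, $\mathcal T_{\mathcal R}(\omega)=\bigcup_{m\in\omega}\mathcal T_{\mathcal R}(m)$, and $G_{\mathcal R}(\omega)=\int_{\mathcal T_{\mathcal R}(\omega)}g(x)\,dx$ for Borel $\omega\subset\bar\Omega^*$; $G_{\mathcal R}(m)$ means $G_{\mathcal R}(\{m\})$. For $\mathbf b=(b_1,\dots,b_N)\in\mathbb R^N_+$, $\mathcal R(\mathbf b)=\{\rho(x)x:x\in\bar\Omega,\ \rho(x)=\min_{1\le i\le N}\frac{b_i}{1-\kappa m_i\cdot x}\}$. *)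

theory Defs
  imports "HOL-Analysis.Analysis"
begin

section \<open>Surface measure on the unit sphere\<close>

text \<open>
  Surface measure \<open>dx\<close> on the unit sphere of \<open>\<real>\<^sup>3\<close>, given by the cone formula
  \<open>\<sigma>(A) = 3 \<cdot> vol {y. \<parallel>y\<parallel> < 1 \<and> y / \<parallel>y\<parallel> \<in> A}\<close>; the factor \<open>3\<close> is the dimension of the ambient
  space, so that the total mass is \<open>4\<pi>\<close>. It is realised as a complete measure on all of
  \<open>\<real>\<^sup>3\<close> that is concentrated on the sphere.
\<close>

definition surface_measure :: "(real^3) measure" where
  "surface_measure =
     completion (scale_measure 3 (distr (restrict_space lborel (ball 0 1)) borel sgn))"

lemma sgn_borel_measurable_vec: "(sgn :: real^3 \<Rightarrow> real^3) \<in> borel_measurable borel"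
  unfolding sgn_div_norm by measurable

lemma emeasure_surface_measure:
  assumes "A \<in> sets borel"
  shows "emeasure surface_measure A = 3 * emeasure lborel {y \<in> ball 0 1. sgn y \<in> A}"
proof -
  have meas: "(sgn :: real^3 \<Rightarrow> real^3) \<in> restrict_space lborel (ball 0 1) \<rightarrow>\<^sub>M borel"
    using sgn_borel_measurable_vec by (intro measurable_restrict_space1) simp
  have sp: "space (restrict_space lborel (ball 0 1)) = (ball 0 1 :: (real^3) set)"
    by (simp add: space_restrict_space)
  have "sgn -` A \<inter> ball 0 1 = {y \<in> ball 0 1. sgn y \<in> A}"
    by auto
  moreover have "emeasure (restrict_space lborel (ball 0 1)) {y \<in> ball 0 1. sgn y \<in> A}
      = emeasure lborel {y \<in> ball 0 1. sgn y \<in> A}"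
    by (intro emeasure_restrict_space) auto
  ultimately show ?thesis
    using assms meas
    by (simp add: surface_measure_def emeasure_distr sp del: mem_ball)
qed

lemma emeasure_surface_measure_sphere:
  "emeasure surface_measure (sphere 0 1) = ennreal (4 * pi)"
proof -
  have eq: "{y \<in> ball 0 1. sgn y \<in> sphere 0 1} = ball (0::real^3) 1 - {0}"
    by (auto simp: norm_sgn)
  have "emeasure lborel (ball (0::real^3) 1 - {0}) = emeasure lborel (ball (0::real^3) 1)"
    by (intro emeasure_Diff_null_set) auto
  also have "\<dots> = ennreal (4 / 3 * pi)"
    using emeasure_ball[of 1 "0::real^3"] unit_ball_vol_3 by simp
  finally have "emeasure surface_measure (sphere 0 1) = 3 * ennreal (4 / 3 * pi)"
    by (subst emeasure_surface_measure) (simp_all only: eq borel_closed closed_sphere)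
  then show ?thesis
    by (simp flip: ennreal_mult'' ennreal_numeral)
qed

definition sphere_domain :: "(real^3) set \<Rightarrow> bool" where
  "sphere_domain \<Omega> \<longleftrightarrow>
     \<Omega> \<noteq> {} \<and> openin (top_of_set (sphere 0 1)) \<Omega> \<and> connected \<Omega>"

section \<open>Refractors\<close>

text \<open>
  A surface \<open>{\<rho>(x) x | x \<in> closure \<Omega>}\<close> is represented by its radial function \<open>\<rho>\<close>; only the values
  of \<open>\<rho>\<close> on \<open>closure \<Omega>\<close> matter. In the same way, the semi-ellipsoid
  \<open>E(m,b) = {\<rho>(x) x | x \<in> sphere 0 1, m \<bullet> x \<ge> \<kappa>}\<close> is represented by its radial function; the
  restriction \<open>m \<bullet> x \<ge> \<kappa>\<close> holds at every \<open>x \<in> closure \<Omega>\<close>, by the standing assumption on \<open>\<Omega>\<close> and \<open>\<Omega>'\<close>,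
  whenever \<open>m \<in> closure \<Omega>'\<close>.
\<close>

definition ellipsoid_radius :: "real \<Rightarrow> real^3 \<Rightarrow> real \<Rightarrow> real^3 \<Rightarrow> real" where
  "ellipsoid_radius \<kappa> m b x = b / (1 - \<kappa> * (m \<bullet> x))"

definition ellipsoid_supports ::
    "real \<Rightarrow> (real^3) set \<Rightarrow> real^3 \<Rightarrow> real \<Rightarrow> (real^3 \<Rightarrow> real) \<Rightarrow> real^3 \<Rightarrow> bool" where
  "ellipsoid_supports \<kappa> \<Omega> m b \<rho> x\<^sub>0 \<longleftrightarrow>
     \<rho> x\<^sub>0 = ellipsoid_radius \<kappa> m b x\<^sub>0 \<and>
     (\<forall>x \<in> closure \<Omega>. \<rho> x \<le> ellipsoid_radius \<kappa> m b x)"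

definition refractor ::
    "real \<Rightarrow> (real^3) set \<Rightarrow> (real^3) set \<Rightarrow> (real^3 \<Rightarrow> real) \<Rightarrow> bool" where
  "refractor \<kappa> \<Omega> \<Omega>' \<rho> \<longleftrightarrow>
     (\<forall>x\<^sub>0 \<in> closure \<Omega>. \<exists>m \<in> closure \<Omega>'. \<exists>b > 0. ellipsoid_supports \<kappa> \<Omega> m b \<rho> x\<^sub>0)"

definition tracing_map ::
    "real \<Rightarrow> (real^3) set \<Rightarrow> (real^3 \<Rightarrow> real) \<Rightarrow> (real^3) set \<Rightarrow> (real^3) set" where
  "tracing_map \<kappa> \<Omega> \<rho> \<omega> =
     (\<Union>m \<in> \<omega>. {x \<in> closure \<Omega>. \<exists>b > 0. ellipsoid_supports \<kappa> \<Omega> m b \<rho> x})"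

definition refractor_measure ::
    "real \<Rightarrow> (real^3) set \<Rightarrow> (real^3 \<Rightarrow> real) \<Rightarrow> (real^3 \<Rightarrow> real) \<Rightarrow> (real^3) set \<Rightarrow> real" where
  "refractor_measure \<kappa> \<Omega> g \<rho> \<omega> = (LINT x : tracing_map \<kappa> \<Omega> \<rho> \<omega> | surface_measure. g x)"

text \<open>
  A vector \<open>\<bold>b \<in> \<real>\<^sup>N\<close> is a function on \<open>nat\<close> of which only the values at \<open>1, \<dots>, N\<close> are used.
\<close>

definition min_refractor ::
    "real \<Rightarrow> nat \<Rightarrow> (nat \<Rightarrow> real^3) \<Rightarrow> (nat \<Rightarrow> real) \<Rightarrow> real^3 \<Rightarrow> real" where
  "min_refractor \<kappa> N m b x = (MIN i \<in> {1..N}. ellipsoid_radius \<kappa> (m i) (b i) x)"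

lemma refractor_min_refractor:
  assumes "1 \<le> N" "\<forall>i \<in> {1..N}. m i \<in> closure \<Omega>'" "\<forall>i \<in> {1..N}. 0 < b i"
  shows "refractor \<kappa> \<Omega> \<Omega>' (min_refractor \<kappa> N m b)"
  unfolding refractor_def
proof
  fix x\<^sub>0
  let ?f = "\<lambda>x i. ellipsoid_radius \<kappa> (m i) (b i) x"
  have "Min (?f x\<^sub>0 ` {1..N}) \<in> ?f x\<^sub>0 ` {1..N}"
    using assms(1) by (intro Min_in) auto
  then obtain i where i: "i \<in> {1..N}" "min_refractor \<kappa> N m b x\<^sub>0 = ?f x\<^sub>0 i"
    unfolding min_refractor_def by blast
  have "min_refractor \<kappa> N m b x \<le> ?f x i" for x
    using i(1) unfolding min_refractor_def by (intro Min_le) auto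
  with i assms(2,3) show
    "\<exists>m' \<in> closure \<Omega>'. \<exists>b' > 0. ellipsoid_supports \<kappa> \<Omega> m' b' (min_refractor \<kappa> N m b) x\<^sub>0"
    unfolding ellipsoid_supports_def by blast
qed

end

theory Submission
  imports Defs
begin

text \<open>
  Up to a null set, \<open>G\<^sub>i(b)\<close> integrates \<open>g\<close> over the set where the \<open>i\<close>-th ellipsoid realises the
  minimum. Decreasing \<open>b\<^sub>i\<close> by \<open>-t\<close> enlarges this set, and each new point lies, for some \<open>r \<noteq> i\<close>, in the
  slab where \<open>h = (1 - \<kappa> m\<^sub>i \<bullet> x) / (1 - \<kappa> m\<^sub>r \<bullet> x)\<close> takes values in \<open>[(b\<^sub>i + t) / b\<^sub>r, b\<^sub>i / b\<^sub>r)\<close>.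
  Extend \<open>h\<close> homogeneously to the convex cone \<open>m\<^sub>i \<bullet> y \<ge> \<kappa> |y|\<close>, \<open>m\<^sub>r \<bullet> y \<ge> \<kappa> |y|\<close>. Inside the unit ball it
  grows at rate at least \<open>\<delta> = 2 \<kappa>\<^sup>3 (1 - c)\<^sup>2 / (1 + c)\<close>, \<open>c = m\<^sub>i \<bullet> m\<^sub>r\<close>, along \<open>m\<^sub>r - m\<^sub>i\<close>, by positivity of
  the Gram determinant. Hence translates of a slab of width \<open>w\<close> by multiples of \<open>(w / \<delta>) (m\<^sub>r - m\<^sub>i)\<close> are
  disjoint, and packing them into the ball of radius \<open>2\<close> bounds the measure of the slab linearly in \<open>w\<close>.
\<close>

section \<open>Inner product inequalities for unit vectors\<close>

text \<open>Cauchy-Schwarz for the components of \<open>m\<close> and \<open>n\<close> orthogonal to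
  \<open>x\<close>. The right side minus the left side is the Gram determinant of \<open>m\<close>,
  \<open>n\<close>, \<open>x\<close>.\<close>

lemma gram_determinant_nonneg:
  fixes m n x :: "'a::real_inner"
  assumes "norm m = 1" "norm n = 1" "norm x = 1"
  shows "(m \<bullet> x)\<^sup>2 + (n \<bullet> x)\<^sup>2 + (m \<bullet> n)\<^sup>2 \<le> 1 + 2 * (m \<bullet> n) * (m \<bullet> x) * (n \<bullet> x)"
proof -
  define p q c where "p = m \<bullet> x" and "q = n \<bullet> x" and "c = m \<bullet> n"
  have mm: "m \<bullet> m = 1" "n \<bullet> n = 1" "x \<bullet> x = 1"
    using assms by (simp_all add: dot_square_norm)
  have "((m - p *\<^sub>R x) \<bullet> (n - q *\<^sub>R x))\<^sup>2
      \<le> ((m - p *\<^sub>R x) \<bullet> (m - p *\<^sub>R x)) * ((n - q *\<^sub>R x) \<bullet> (n - q *\<^sub>R x))"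
    by (rule Cauchy_Schwarz_ineq)
  moreover have "(m - p *\<^sub>R x) \<bullet> (n - q *\<^sub>R x) = c - p * q"
    "(m - p *\<^sub>R x) \<bullet> (m - p *\<^sub>R x) = 1 - p\<^sup>2"
    "(n - q *\<^sub>R x) \<bullet> (n - q *\<^sub>R x) = 1 - q\<^sup>2"
    using mm by (simp_all add: inner_diff_left inner_diff_right inner_commute p_def q_def c_def
        power2_eq_square)
  ultimately have "(c - p * q)\<^sup>2 \<le> (1 - p\<^sup>2) * (1 - q\<^sup>2)"
    by simp
  then have "p\<^sup>2 + q\<^sup>2 + c\<^sup>2 \<le> 1 + 2 * c * p * q"
    by (simp add: power2_eq_square algebra_simps)
  then show ?thesis
    by (simp add: p_def q_def c_def)
qed

text \<open>Pairing \<open>m + n\<close> with \<open>x\<close> excludes \<open>n = - m\<close>. This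
  keeps the denominator \<open>1 + m \<bullet> n\<close> of the later bounds positive.\<close>

lemma directions_not_opposite:
  fixes m n x :: "'a::real_inner"
  assumes "norm m = 1" "norm n = 1" "0 < m \<bullet> x" "0 < n \<bullet> x"
  shows "-1 < m \<bullet> n"
proof -
  have "m + n \<noteq> 0"
    using assms(3,4) by (metis add_pos_pos inner_add_left inner_zero_left less_irrefl)
  then have "0 < (m + n) \<bullet> (m + n)"
    by simp
  also have "\<dots> = 2 + 2 * (m \<bullet> n)"
    using assms(1,2) unfolding norm_eq_1
    by (simp add: inner_add_left inner_add_right inner_commute)
  finally show ?thesis
    by simp
qed

lemma inner_less_one:
  fixes m n :: "'a::real_inner"
  assumes "norm m = 1" "norm n = 1" "m \<noteq> n"
  shows "m \<bullet> n < 1"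
proof -
  have "0 < (m - n) \<bullet> (m - n)"
    using assms(3) by simp
  also have "\<dots> = 2 - 2 * (m \<bullet> n)"
    using assms(1,2) unfolding norm_eq_1
    by (simp add: inner_diff_left inner_diff_right inner_commute)
  finally show ?thesis
    by simp
qed

text \<open>Up to a positive factor, the right-hand side is the derivative of
  \<open>cone_ratio\<close> along \<open>n - m\<close>. The Gram inequality controls the subtracted
  square, and the lower bound \<open>\<kappa>\<close> on both inner products keeps what is left away
  from zero.\<close>

lemma slope_numerator_bound:
  fixes m n x :: "'a::real_inner"
  assumes "norm m = 1" "norm n = 1" "norm x = 1" "m \<noteq> n"
    and "0 < \<kappa>" "\<kappa> < 1" "\<kappa> \<le> m \<bullet> x" "\<kappa> \<le> n \<bullet> x"
  shows "2 * \<kappa>\<^sup>2 * (1 - m \<bullet> n)\<^sup>2 / (1 + m \<bullet> n)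
    \<le> (1 - m \<bullet> n) * (2 - \<kappa> * (m \<bullet> x + n \<bullet> x)) - (n \<bullet> x - m \<bullet> x)\<^sup>2"
proof -
  define p q c where "p = m \<bullet> x" and "q = n \<bullet> x" and "c = m \<bullet> n"
  have c: "-1 < c" "c < 1"
    using directions_not_opposite[of m n x] inner_less_one[of m n] assms by (auto simp: c_def)
  have gram: "p\<^sup>2 + q\<^sup>2 + c\<^sup>2 \<le> 1 + 2 * c * p * q"
    using gram_determinant_nonneg[OF assms(1-3)] by (simp add: p_def q_def c_def)
  define s where "s = p + q"
  have s: "2 * \<kappa> \<le> s"
    using assms by (simp add: s_def p_def q_def)
  have "\<kappa> * (1 + c) \<le> \<kappa> * 2"
    using c assms by (intro mult_left_mono) auto
  then have "\<kappa> * (1 - c) \<le> s - \<kappa> * (1 + c)"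
    using s by (simp add: algebra_simps)
  then have "(2 * \<kappa>) * (\<kappa> * (1 - c)) \<le> s * (s - \<kappa> * (1 + c))"
    using s c assms by (intro mult_mono) auto
  then have "(1 - c) * ((2 * \<kappa>) * (\<kappa> * (1 - c))) \<le> (1 - c) * (s * (s - \<kappa> * (1 + c)))"
    using c by (intro mult_left_mono) auto
  \<comment> \<open>The Gram inequality in the variables \<open>p + q\<close> and
    \<open>q - p\<close>, in which the mixed term disappears.\<close>
  moreover have "(1 - c) * s\<^sup>2 + (1 + c) * (q - p)\<^sup>2 \<le> 2 * (1 - c\<^sup>2)"
    using gram by (simp add: s_def power2_eq_square algebra_simps)
  ultimately have "2 * \<kappa>\<^sup>2 * (1 - c)\<^sup>2
      \<le> ((1 - c) * (2 - \<kappa> * s) - (q - p)\<^sup>2) * (1 + c)"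
    by (simp add: power2_eq_square algebra_simps)
  then have "2 * \<kappa>\<^sup>2 * (1 - c)\<^sup>2 / (1 + c) \<le> (1 - c) * (2 - \<kappa> * s) - (q - p)\<^sup>2"
    using c by (simp add: pos_divide_le_eq)
  then show ?thesis
    by (simp add: p_def q_def c_def s_def)
qed

section \<open>The ratio of denominators on a convex cone\<close>

text \<open>The extension, homogeneous of degree 0, of \<open>(1 - \<kappa> * (m \<bullet> x)) / (1
  - \<kappa> * (n \<bullet> x))\<close> from unit vectors \<open>x\<close>. Off the sphere it can be
  followed along straight lines, so that translations of space become available.\<close>

definition cone_ratio :: "real \<Rightarrow> 'a::real_inner \<Rightarrow> 'a \<Rightarrow> 'a \<Rightarrow> real" where
  "cone_ratio \<kappa> m n y = (norm y - \<kappa> * (m \<bullet> y)) / (norm y - \<kappa> * (n \<bullet> y))"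

lemma norm_diff_inner_pos:
  fixes n y :: "'a::real_inner"
  assumes "norm n = 1" "0 < \<kappa>" "\<kappa> < 1" "y \<noteq> 0"
  shows "0 < norm y - \<kappa> * (n \<bullet> y)"
proof -
  have "\<kappa> * (n \<bullet> y) \<le> \<kappa> * norm y"
    using norm_cauchy_schwarz[of n y] assms by (intro mult_left_mono) auto
  also have "\<dots> < norm y"
    using assms by simp
  finally show ?thesis
    by simp
qed

text \<open>With \<open>z = R *\<^sub>R x\<close> and \<open>norm x = 1\<close>, the quotient rule
  gives \<open>D = \<kappa> * W / (R * (1 - \<kappa> * q)\<^sup>2)\<close>, where \<open>W\<close>
  is the quantity bounded in \<open>slope_numerator_bound\<close>.\<close>

lemma cone_ratio_deriv:
  fixes m n y :: "'a::real_inner"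
  assumes mn: "norm m = 1" "norm n = 1" "m \<noteq> n" and \<kappa>: "0 < \<kappa>" "\<kappa> < 1"
    and z: "y + s *\<^sub>R (n - m) \<noteq> 0" "norm (y + s *\<^sub>R (n - m)) \<le> 1"
      "\<kappa> * norm (y + s *\<^sub>R (n - m)) \<le> m \<bullet> (y + s *\<^sub>R (n - m))"
      "\<kappa> * norm (y + s *\<^sub>R (n - m)) \<le> n \<bullet> (y + s *\<^sub>R (n - m))"
  shows "\<exists>D. ((\<lambda>s. cone_ratio \<kappa> m n (y + s *\<^sub>R (n - m))) has_real_derivative D) (at s)
    \<and> 2 * \<kappa>^3 * (1 - m \<bullet> n)\<^sup>2 / (1 + m \<bullet> n) \<le> D"
proof -
  define z where "z = y + s *\<^sub>R (n - m)"
  define x where "x = z /\<^sub>R norm z"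
  define c where "c = m \<bullet> n"
  define p q where "p = m \<bullet> x" and "q = n \<bullet> x"
  define R where "R = norm z"
  have R: "0 < R" "R \<le> 1"
    using z by (auto simp: R_def z_def)
  have x: "norm x = 1" "z = R *\<^sub>R x"
    using R by (auto simp: x_def R_def)
  have pq: "m \<bullet> z = R * p" "n \<bullet> z = R * q"
    by (auto simp: x p_def q_def)
  have pk: "\<kappa> \<le> p" "\<kappa> \<le> q"
    using z(3,4) R by (simp_all flip: z_def R_def add: pq)
  have "0 \<le> \<kappa> * q"
    using \<kappa> pk by (intro mult_nonneg_nonneg) linarith+
  moreover have "x \<noteq> 0"
    using x(1) by auto
  ultimately have Q: "0 < 1 - \<kappa> * q" "1 - \<kappa> * q \<le> 1"
    using norm_diff_inner_pos[OF mn(2) \<kappa>, of x] x(1) by (simp_all flip: q_def)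
  have mm: "m \<bullet> m = 1" "n \<bullet> n = 1" "n \<bullet> m = c"
    using mn by (simp_all add: dot_square_norm inner_commute c_def)
  have dline: "((\<lambda>s. y + s *\<^sub>R (n - m)) has_derivative (\<lambda>h. h *\<^sub>R (n - m))) (at s)"
    by (auto intro!: derivative_eq_intros)
  have dn: "((\<lambda>s. norm (y + s *\<^sub>R (n - m))) has_real_derivative (q - p)) (at s)"
  proof -
    have "(norm has_derivative (\<lambda>h. h \<bullet> sgn z)) (at z)"
      by (rule has_derivative_norm) (use R R_def in auto)
    from has_derivative_compose[OF dline, of norm, OF this[unfolded z_def]]
    have "((\<lambda>s. norm (y + s *\<^sub>R (n - m))) has_derivative (\<lambda>h. (h *\<^sub>R (n - m)) \<bullet> sgn z)) (at s)"
      by (simp add: z_def)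
    moreover have "sgn z = x"
      by (simp add: sgn_div_norm x_def)
    ultimately show ?thesis
      by (simp add: has_field_derivative_def inner_diff_left p_def q_def mult_commute_abs)
  qed
  have dm: "((\<lambda>s. m \<bullet> (y + s *\<^sub>R (n - m))) has_real_derivative (c - 1)) (at s)"
    using mm by (auto intro!: derivative_eq_intros simp: inner_add_right inner_diff_right c_def)
  have dnn: "((\<lambda>s. n \<bullet> (y + s *\<^sub>R (n - m))) has_real_derivative (1 - c)) (at s)"
    using mm by (auto intro!: derivative_eq_intros simp: inner_add_right inner_diff_right c_def)
  have nz: "norm (y + s *\<^sub>R (n - m)) - \<kappa> * (n \<bullet> (y + s *\<^sub>R (n - m))) \<noteq> 0"
    using norm_diff_inner_pos[OF mn(2) \<kappa> z(1)] by simp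
  define D where "D = (((q - p) - \<kappa> * (c - 1)) * (R - \<kappa> * (R * q))
      - (R - \<kappa> * (R * p)) * ((q - p) - \<kappa> * (1 - c))) / ((R - \<kappa> * (R * q)) * (R - \<kappa> * (R * q)))"
  have 1: "((\<lambda>s. cone_ratio \<kappa> m n (y + s *\<^sub>R (n - m))) has_real_derivative D) (at s)"
    unfolding cone_ratio_def D_def
    using DERIV_divide[OF DERIV_diff[OF dn DERIV_cmult[OF dm, of \<kappa>]]
       DERIV_diff[OF dn DERIV_cmult[OF dnn, of \<kappa>]] nz]
    by (simp only: z_def[symmetric] pq R_def[symmetric])
  define W where "W = (1 - c) * (2 - \<kappa> * (p + q)) - (q - p)\<^sup>2"
  have W: "2 * \<kappa>\<^sup>2 * (1 - c)\<^sup>2 / (1 + c) \<le> W"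
    using slope_numerator_bound[OF mn(1,2) x(1) mn(3) \<kappa>] pk by (simp add: W_def p_def q_def c_def)
  have c: "-1 < c"
    using directions_not_opposite[of m n x] mn pk \<kappa> by (auto simp: c_def p_def q_def)
  have W0: "0 \<le> W"
    using c by (intro order_trans[OF _ W]) auto
  \<comment> \<open>\<open>R \<le> 1\<close> comes from the unit ball and
    \<open>1 - \<kappa> * q \<le> 1\<close> from \<open>q\<close> being positive. Dividing the
    nonnegative \<open>\<kappa> * W\<close> by this number does not decrease it.\<close>
  have den: "0 < R * (1 - \<kappa> * q)\<^sup>2" "R * (1 - \<kappa> * q)\<^sup>2 \<le> 1"
    using R Q by (auto intro!: mult_le_one power_le_one)
  \<comment> \<open>The common factor \<open>R\<close> is kept so that numerators and denominators
    agree separately.\<close>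
  have "D = (R * (\<kappa> * W)) / (R * (R * (1 - \<kappa> * q)\<^sup>2))"
    unfolding D_def W_def by (rule arg_cong2[where f = "(/)"]) (simp_all add: power2_eq_square algebra_simps)
  also have "\<dots> = \<kappa> * W / (R * (1 - \<kappa> * q)\<^sup>2)"
    using R by simp
  also have "\<dots> \<ge> \<kappa> * W"
    using den mult_left_mono[OF den(2), of "\<kappa> * W"] \<kappa> W0
    by (subst pos_le_divide_eq) (auto simp: mult_nonneg_nonneg)
  finally have "\<kappa> * W \<le> D" .
  moreover have "2 * \<kappa>^3 * (1 - c)\<^sup>2 / (1 + c) \<le> \<kappa> * W"
    using mult_left_mono[OF W, of \<kappa>] \<kappa> by (simp add: power2_eq_square power3_eq_cube mult_ac)
  ultimately show ?thesis
    using 1 by (auto simp: c_def)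
qed

text \<open>The derivative bound holds along the whole segment from \<open>y\<close> to
  \<open>z\<close>, because the part of the cone in the unit ball is convex.\<close>

lemma cone_ratio_growth:
  fixes m n y :: "'a::real_inner"
  assumes mn: "norm m = 1" "norm n = 1" "m \<noteq> n" and \<kappa>: "0 < \<kappa>" "\<kappa> < 1"
    and y: "y \<noteq> 0" "norm y \<le> 1" "\<kappa> * norm y \<le> m \<bullet> y" "\<kappa> * norm y \<le> n \<bullet> y"
    and z: "z \<noteq> 0" "norm z \<le> 1" "\<kappa> * norm z \<le> m \<bullet> z" "\<kappa> * norm z \<le> n \<bullet> z"
    and "z = y + \<tau> *\<^sub>R (n - m)" "0 \<le> \<tau>"
  shows "cone_ratio \<kappa> m n y + 2 * \<kappa>^3 * (1 - m \<bullet> n)\<^sup>2 / (1 + m \<bullet> n) * \<tau> \<le> cone_ratio \<kappa> m n z"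
proof -
  define \<delta> where "\<delta> = 2 * \<kappa>^3 * (1 - m \<bullet> n)\<^sup>2 / (1 + m \<bullet> n)"
  \<comment> \<open>The condition \<open>w \<noteq> 0\<close> is not preserved by convex
    combinations; inside the cone \<open>0 < m \<bullet> w\<close> expresses it in a convex
    way.\<close>
  define K where "K = {w. 0 < m \<bullet> w \<and> norm w \<le> 1 \<and> \<kappa> * norm w \<le> m \<bullet> w \<and> \<kappa> * norm w \<le> n \<bullet> w}"
  have "convex K"
    unfolding convex_alt
  proof (intro ballI allI impI)
    fix a b :: 'a and u :: real
    assume ab: "a \<in> K" "b \<in> K" and u: "0 \<le> u \<and> u \<le> 1"
    let ?w = "(1 - u) *\<^sub>R a + u *\<^sub>R b"
    have nw: "norm ?w \<le> (1 - u) * norm a + u * norm b"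
      using norm_triangle_ineq[of "(1 - u) *\<^sub>R a" "u *\<^sub>R b"] u by simp
    have "\<kappa> * norm ?w \<le> (1 - u) * (\<kappa> * norm a) + u * (\<kappa> * norm b)"
      using mult_left_mono[OF nw, of \<kappa>] \<kappa> by (simp add: algebra_simps)
    moreover have "(1 - u) * (\<kappa> * norm a) + u * (\<kappa> * norm b) \<le> (1 - u) * (m \<bullet> a) + u * (m \<bullet> b)"
      "(1 - u) * (\<kappa> * norm a) + u * (\<kappa> * norm b) \<le> (1 - u) * (n \<bullet> a) + u * (n \<bullet> b)"
      using ab u by (auto simp: K_def intro!: add_mono mult_left_mono)
    moreover have "norm ?w \<le> 1"
      using nw convex_bound_le[of "norm a" 1 "norm b" "1 - u" u] ab u by (simp add: K_def)
    moreover have "0 < (1 - u) * (m \<bullet> a) + u * (m \<bullet> b)"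
      using ab u by (cases "u = 0") (auto simp: K_def intro!: add_nonneg_pos mult_pos_pos)
    ultimately show "?w \<in> K"
      by (simp add: K_def inner_add_right)
  qed
  moreover have "0 < \<kappa> * norm y" "0 < \<kappa> * norm z"
    using y z \<kappa> by auto
  then have yz: "y \<in> K" "z \<in> K"
    using y z by (auto simp: K_def)
  ultimately have seg: "y + s *\<^sub>R (n - m) \<in> K" if "0 \<le> s" "s \<le> \<tau>" for s
  proof (cases "\<tau> = 0")
    case True
    then show ?thesis
      using that yz by simp
  next
    case False
    have "0 \<le> s / \<tau>" "s / \<tau> \<le> 1"
      using that False by (auto simp: divide_simps)
    then have "(1 - s / \<tau>) *\<^sub>R y + (s / \<tau>) *\<^sub>R z \<in> K"
      using \<open>convex K\<close> yz by (simp add: convex_alt)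
    moreover have "(1 - s / \<tau>) *\<^sub>R y + (s / \<tau>) *\<^sub>R z = y + s *\<^sub>R (n - m)"
      using False by (simp add: assms(14) scaleR_add_right algebra_simps)
    ultimately show ?thesis
      by simp
  qed
  let ?f = "\<lambda>s. cone_ratio \<kappa> m n (y + s *\<^sub>R (n - m))"
  \<comment> \<open>Subtracting the linear function of slope \<open>\<delta>\<close> reduces the
    growth estimate to monotonicity.\<close>
  have "?f 0 - \<delta> * 0 \<le> ?f \<tau> - \<delta> * \<tau>"
  proof (rule DERIV_nonneg_imp_nondecreasing[OF \<open>0 \<le> \<tau>\<close>])
    fix s assume s: "0 \<le> s" "s \<le> \<tau>"
    have "y + s *\<^sub>R (n - m) \<noteq> 0"
      using seg[OF s] by (auto simp: K_def)
    then obtain D where "(?f has_real_derivative D) (at s)" "\<delta> \<le> D"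
      using cone_ratio_deriv[OF mn \<kappa>, of y s] seg[OF s] by (auto simp: K_def \<delta>_def)
    moreover have "((\<lambda>s. ?f s - \<delta> * s) has_real_derivative (D - \<delta>)) (at s)"
      using calculation(1) by (auto intro!: derivative_eq_intros)
    ultimately show "\<exists>D. ((\<lambda>s. ?f s - \<delta> * s) has_real_derivative D) (at s) \<and> 0 \<le> D"
      by (auto intro!: exI[of _ "D - \<delta>"])
  qed
  then show ?thesis
    by (simp add: assms(14) \<delta>_def)
qed

section \<open>Packing disjoint translates into a ball\<close>

text \<open>The translates of \<open>S\<close> by \<open>0, \<eta>, ..., k * \<eta>\<close> times
  \<open>v\<close> are disjoint and lie in the ball of radius 2, so \<open>k + 1\<close> copies of
  the volume of \<open>S\<close> fit there, while \<open>k + 1\<close> is at least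
  \<open>1 / (\<eta> * norm v)\<close>.\<close>

lemma emeasure_lborel_disjoint_translates:
  fixes S :: "'a::euclidean_space set" and v :: 'a
  assumes S: "S \<in> sets borel" "S \<subseteq> ball 0 1" and "0 < \<eta>" "v \<noteq> 0"
    and disj: "\<And>x s. x \<in> S \<Longrightarrow> \<eta> \<le> s \<Longrightarrow> x + s *\<^sub>R v \<notin> S"
  shows "emeasure lborel S \<le> ennreal (\<eta> * norm v) * emeasure lborel (ball (0::'a) 2)"
proof -
  \<comment> \<open>The largest number of shifts of total length at most 1, so that points of the
    unit ball stay within radius 2. For \<open>\<eta> * norm v > 1\<close> it is 0 and only
    \<open>S\<close> itself is packed.\<close>
  define k where "k = nat \<lfloor>1 / (\<eta> * norm v)\<rfloor>"
  have pos: "0 < \<eta> * norm v"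
    using assms by simp
  have k1: "real k * (\<eta> * norm v) \<le> 1"
  proof -
    have "real k \<le> 1 / (\<eta> * norm v)"
      using pos by (simp add: k_def)
    then show ?thesis
      using pos by (simp add: pos_le_divide_eq)
  qed
  have k2: "1 \<le> (\<eta> * norm v) * real (Suc k)"
  proof -
    have "1 / (\<eta> * norm v) \<le> real (Suc k)"
      unfolding k_def by linarith
    then show ?thesis
      using pos by (simp add: pos_divide_le_eq mult.commute)
  qed
  let ?T = "\<lambda>j. (+) ((real j * \<eta>) *\<^sub>R v) ` S"
  have T: "emeasure lborel (?T j) = emeasure lborel S \<and> ?T j \<in> sets borel" for j
  proof -
    have eq: "?T j = (\<lambda>x. x - (real j * \<eta>) *\<^sub>R v) -` S"
      by (auto simp: image_iff algebra_simps intro!: bexI[of _ "_ - _"])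
    have "(\<lambda>x. x - (real j * \<eta>) *\<^sub>R v) \<in> borel \<rightarrow>\<^sub>M borel"
      by measurable
    then have sb: "?T j \<in> sets borel"
      unfolding eq using S(1) by (rule measurable_sets_borel)
    have "emeasure lborel (?T j) = emeasure (distr lborel borel ((+) ((real j * \<eta>) *\<^sub>R v))) (?T j)"
      by (simp add: lborel_distr_plus)
    also have "\<dots> = emeasure lborel ((+) ((real j * \<eta>) *\<^sub>R v) -` ?T j)"
      using sb by (subst emeasure_distr) auto
    also have "(+) ((real j * \<eta>) *\<^sub>R v) -` ?T j = S"
      by auto
    finally show ?thesis
      using sb by simp
  qed
  \<comment> \<open>A common point of two translates would give a point of \<open>S\<close> carried
    back into \<open>S\<close> by a shift of at least \<open>\<eta>\<close>.\<close>
  have noshift: False if ij: "i < j" "x \<in> ?T i" "x \<in> ?T j" for i j :: nat and x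
  proof -
    obtain a b where ab: "a \<in> S" "b \<in> S" "x = (real i * \<eta>) *\<^sub>R v + a" "x = (real j * \<eta>) *\<^sub>R v + b"
      using ij(2,3) by blast
    have "a = b + ((real j - real i) * \<eta>) *\<^sub>R v"
      using ab(3,4) by (simp add: algebra_simps)
    moreover have "\<eta> \<le> (real j - real i) * \<eta>"
      using ij(1) \<open>0 < \<eta>\<close> by simp
    ultimately show False
      using disj[of b] ab by blast
  qed
  have dj: "disjoint_family_on ?T {..k}"
    unfolding disjoint_family_on_def by (metis noshift disjoint_iff linorder_neqE_nat)
  have sub: "(\<Union>j\<in>{..k}. ?T j) \<subseteq> ball 0 2"
  proof (intro UN_least image_subsetI)
    fix j x assume "j \<in> {..k}" and x: "x \<in> S"
    then have "real j * (\<eta> * norm v) \<le> 1"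
      using pos by (intro order_trans[OF mult_right_mono k1]) auto
    moreover have "norm x < 1"
      using S x by auto
    moreover have "norm ((real j * \<eta>) *\<^sub>R v + x) \<le> real j * (\<eta> * norm v) + norm x"
      using norm_triangle_ineq[of "(real j * \<eta>) *\<^sub>R v" x] \<open>0 < \<eta>\<close> by (simp add: mult.assoc)
    ultimately show "(real j * \<eta>) *\<^sub>R v + x \<in> ball 0 2"
      by simp
  qed
  have "of_nat (Suc k) * emeasure lborel S = (\<Sum>j\<in>{..k}. emeasure lborel (?T j))"
    using T by simp
  also have "\<dots> = emeasure lborel (\<Union>j\<in>{..k}. ?T j)"
    using T dj by (intro sum_emeasure) auto
  also have "\<dots> \<le> emeasure lborel (ball (0::'a) 2)"
    using sub by (intro emeasure_mono) auto
  finally have *: "of_nat (Suc k) * emeasure lborel S \<le> emeasure lborel (ball (0::'a) 2)" .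
  have "emeasure lborel S = 1 * emeasure lborel S"
    by simp
  also have "\<dots> \<le> ennreal ((\<eta> * norm v) * real (Suc k)) * emeasure lborel S"
    using k2 by (intro mult_right_mono) auto
  also have "\<dots> = ennreal (\<eta> * norm v) * (of_nat (Suc k) * emeasure lborel S)"
    using pos by (simp only: ennreal_mult'[OF less_imp_le[OF pos]] ennreal_of_nat_eq_real_of_nat mult.assoc[of "ennreal _"])
  also have "\<dots> \<le> ennreal (\<eta> * norm v) * emeasure lborel (ball (0::'a) 2)"
    using * by (intro mult_left_mono) auto
  finally show ?thesis .
qed

section \<open>Surface measure of slabs and level sets of the ratio\<close>

text \<open>
  This is \<open>3 \<cdot> 2 / \<delta> \<cdot> vol (ball 0 2)\<close>, with \<open>3\<close> from the cone formula and \<open>2\<close> bounding \<open>|n - m|\<close>.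
\<close>

definition slab_constant :: "real \<Rightarrow> real \<Rightarrow> real" where
  "slab_constant \<kappa> c = 32 * pi * (1 + c) / (\<kappa>^3 * (1 - c)\<^sup>2)"

text \<open>Half-open, so that raising the ratio by exactly \<open>\<beta> - \<alpha>\<close>
  already leaves the slab. The two cone conditions are included because the growth estimate holds
  only there.\<close>

definition ratio_slab :: "real \<Rightarrow> real^3 \<Rightarrow> real^3 \<Rightarrow> real \<Rightarrow> real \<Rightarrow> (real^3) set" where
  "ratio_slab \<kappa> m n \<alpha> \<beta> =
     {x \<in> sphere 0 1. \<kappa> \<le> m \<bullet> x \<and> \<kappa> \<le> n \<bullet> x \<and>
        \<alpha> \<le> (1 - \<kappa> * (m \<bullet> x)) / (1 - \<kappa> * (n \<bullet> x)) \<and>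
        (1 - \<kappa> * (m \<bullet> x)) / (1 - \<kappa> * (n \<bullet> x)) < \<beta>}"

lemma ratio_slab_borel: "ratio_slab \<kappa> m n \<alpha> \<beta> \<in> sets borel"
proof -
  have "ratio_slab \<kappa> m n \<alpha> \<beta> =
     {x \<in> space borel. norm x = 1 \<and> \<kappa> \<le> m \<bullet> x \<and> \<kappa> \<le> n \<bullet> x \<and>
        \<alpha> \<le> (1 - \<kappa> * (m \<bullet> x)) / (1 - \<kappa> * (n \<bullet> x)) \<and>
        (1 - \<kappa> * (m \<bullet> x)) / (1 - \<kappa> * (n \<bullet> x)) < \<beta>}"
    by (auto simp: ratio_slab_def)
  also have "\<dots> \<in> sets borel"
    by measurable
  finally show ?thesis .
qed

text \<open>By the cone formula the measure is three times the volume of the solid cone over the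
  slab. A shift of that cone by at least \<open>(\<beta> - \<alpha>) / \<delta>\<close> along
  \<open>n - m\<close> leaves it, and the packing bound applies.\<close>

lemma emeasure_ratio_slab:
  assumes mn: "norm m = 1" "norm n = 1" "m \<noteq> n" and \<kappa>: "0 < \<kappa>" "\<kappa> < 1" and "\<alpha> < \<beta>"
  shows "emeasure surface_measure (ratio_slab \<kappa> m n \<alpha> \<beta>)
    \<le> ennreal (slab_constant \<kappa> (m \<bullet> n) * (\<beta> - \<alpha>))"
proof (cases "ratio_slab \<kappa> m n \<alpha> \<beta> = {}")
  case True
  then show ?thesis by simp
next
  case False
  define c where "c = m \<bullet> n"
  \<comment> \<open>A point of the slab is what shows \<open>-1 < c\<close> and hence
    \<open>0 < \<delta>\<close>; this is why the empty slab is treated apart.\<close>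
  obtain x where "x \<in> ratio_slab \<kappa> m n \<alpha> \<beta>"
    using False by auto
  then have c: "-1 < c" "c < 1"
    using directions_not_opposite[OF mn(1,2), of x] inner_less_one[OF mn] \<kappa>
    by (auto simp: c_def ratio_slab_def)
  define \<delta> where "\<delta> = 2 * \<kappa>^3 * (1 - c)\<^sup>2 / (1 + c)"
  have \<delta>: "0 < \<delta>"
    using c \<kappa> by (simp add: \<delta>_def)
  define S where "S = {y \<in> ball 0 1. sgn y \<in> ratio_slab \<kappa> m n \<alpha> \<beta>}"
  have "S = ball 0 1 \<inter> sgn -` ratio_slab \<kappa> m n \<alpha> \<beta>"
    by (auto simp: S_def)
  then have S: "S \<in> sets borel"
    using measurable_sets[OF sgn_borel_measurable_vec ratio_slab_borel[of \<kappa> m n \<alpha> \<beta>]] by auto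
  have Sd: "y \<noteq> 0 \<and> norm y \<le> 1 \<and> \<kappa> * norm y \<le> m \<bullet> y \<and> \<kappa> * norm y \<le> n \<bullet> y
      \<and> \<alpha> \<le> cone_ratio \<kappa> m n y \<and> cone_ratio \<kappa> m n y < \<beta>" if "y \<in> S" for y
  proof -
    have y: "sgn y \<in> ratio_slab \<kappa> m n \<alpha> \<beta>" "norm y < 1"
      using that by (auto simp: S_def)
    \<comment> \<open>\<open>sgn 0 = 0\<close> is not a unit vector, so the solid cone omits its
      apex.\<close>
    then have y0: "y \<noteq> 0"
      by (auto simp: ratio_slab_def)
    have e: "v \<bullet> sgn y = (v \<bullet> y) / norm y" for v
      by (simp add: sgn_div_norm divide_inverse_commute)
    have "(1 - \<kappa> * (m \<bullet> sgn y)) / (1 - \<kappa> * (n \<bullet> sgn y)) =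
        (norm y * (1 - \<kappa> * (m \<bullet> sgn y))) / (norm y * (1 - \<kappa> * (n \<bullet> sgn y)))"
      using y0 by (intro mult_divide_mult_cancel_left[symmetric]) simp
    also have "\<dots> = cone_ratio \<kappa> m n y"
      using y0 by (simp add: cone_ratio_def e right_diff_distrib)
    finally show ?thesis
      using y y0 by (auto simp: ratio_slab_def e pos_le_divide_eq)
  qed
  have "emeasure lborel S
      \<le> ennreal ((\<beta> - \<alpha>) / \<delta> * norm (n - m)) * emeasure lborel (ball (0::real^3) 2)"
  proof (rule emeasure_lborel_disjoint_translates[OF S])
    show "x + s *\<^sub>R (n - m) \<notin> S" if "x \<in> S" "(\<beta> - \<alpha>) / \<delta> \<le> s" for x s
    proof
      assume "x + s *\<^sub>R (n - m) \<in> S"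
      note z = Sd[OF this] and x = Sd[OF \<open>x \<in> S\<close>]
      have s: "\<beta> - \<alpha> \<le> \<delta> * s"
        using that(2) \<delta> by (simp add: pos_divide_le_eq mult.commute)
      have "0 \<le> s"
        using that(2) \<delta> \<open>\<alpha> < \<beta>\<close> by (meson diff_gt_0_iff_gt divide_pos_pos less_imp_le order_trans)
      then have "cone_ratio \<kappa> m n x + \<delta> * s \<le> cone_ratio \<kappa> m n (x + s *\<^sub>R (n - m))"
        using cone_ratio_growth[OF mn \<kappa>, of x "x + s *\<^sub>R (n - m)" s] x z
        by (simp add: \<delta>_def c_def)
      then show False
        using s x z by linarith
    qed
  qed (use \<delta> \<open>\<alpha> < \<beta>\<close> mn in \<open>auto simp: S_def\<close>)
  also have "emeasure lborel (ball (0::real^3) 2) = ennreal (32 / 3 * pi)"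
    using emeasure_ball[of 2 "0::real^3"] unit_ball_vol_3 by simp
  finally have "emeasure lborel S
      \<le> ennreal ((\<beta> - \<alpha>) / \<delta> * norm (n - m)) * ennreal (32 / 3 * pi)" .
  also have "\<dots> = ennreal ((\<beta> - \<alpha>) / \<delta> * norm (n - m) * (32 / 3 * pi))"
    using \<delta> \<open>\<alpha> < \<beta>\<close> by (intro ennreal_mult[symmetric]) auto
  also have "\<dots> \<le> ennreal ((\<beta> - \<alpha>) / \<delta> * 2 * (32 / 3 * pi))"
    using norm_triangle_ineq4[of n m] mn \<delta> \<open>\<alpha> < \<beta>\<close>
    by (intro ennreal_leI mult_right_mono mult_left_mono) auto
  finally have "3 * emeasure lborel S \<le> 3 * ennreal ((\<beta> - \<alpha>) / \<delta> * 2 * (32 / 3 * pi))"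
    by (rule mult_left_mono) simp
  also have "\<dots> = ennreal (3 * ((\<beta> - \<alpha>) / \<delta> * 2 * (32 / 3 * pi)))"
    using \<delta> \<open>\<alpha> < \<beta>\<close> by (subst ennreal_mult) auto
  also have "3 * ((\<beta> - \<alpha>) / \<delta> * 2 * (32 / 3 * pi)) = slab_constant \<kappa> c * (\<beta> - \<alpha>)"
    using c \<kappa> by (simp add: slab_constant_def \<delta>_def field_simps)
  finally show ?thesis
    using emeasure_surface_measure[OF ratio_slab_borel[of \<kappa> m n \<alpha> \<beta>]]
    by (simp add: S_def c_def del: mem_ball)
qed

text \<open>A level set lies in slabs of arbitrarily small width, and their measure is linear in the
  width.\<close>

lemma ratio_level_null:
  assumes mn: "norm m = 1" "norm n = 1" "m \<noteq> n" and \<kappa>: "0 < \<kappa>" "\<kappa> < 1"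
  shows "{x \<in> sphere 0 1. \<kappa> \<le> m \<bullet> x \<and> \<kappa> \<le> n \<bullet> x \<and>
     (1 - \<kappa> * (m \<bullet> x)) / (1 - \<kappa> * (n \<bullet> x)) = \<alpha>} \<in> null_sets surface_measure" (is "?L \<in> _")
proof -
  have "?L = {x \<in> space borel. norm x = 1 \<and> \<kappa> \<le> m \<bullet> x \<and> \<kappa> \<le> n \<bullet> x \<and>
     (1 - \<kappa> * (m \<bullet> x)) / (1 - \<kappa> * (n \<bullet> x)) = \<alpha>}"
    by auto
  also have "\<dots> \<in> sets borel"
    by measurable
  finally have L: "?L \<in> sets surface_measure"
    by (simp add: surface_measure_def)
  have slab_sets: "ratio_slab \<kappa> m n \<alpha> \<beta> \<in> sets surface_measure" for \<beta>
    using ratio_slab_borel by (simp add: surface_measure_def)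
  have "emeasure surface_measure ?L \<le> 0"
  proof (rule ennreal_le_epsilon)
    fix e :: real assume e: "0 < e"
    define a where "a = slab_constant \<kappa> (m \<bullet> n)"
    \<comment> \<open>Chosen so that \<open>a * \<epsilon> \<le> e\<close> whatever the sign of
      \<open>a\<close>; the added 1 covers \<open>a = 0\<close>.\<close>
    define \<epsilon> where "\<epsilon> = e / (\<bar>a\<bar> + 1)"
    have \<epsilon>: "0 < \<epsilon>"
      using e by (simp add: \<epsilon>_def)
    have "emeasure surface_measure ?L \<le> emeasure surface_measure (ratio_slab \<kappa> m n \<alpha> (\<alpha> + \<epsilon>))"
      using \<epsilon> by (intro emeasure_mono slab_sets) (auto simp: ratio_slab_def)
    also have "\<dots> \<le> ennreal (a * \<epsilon>)"
      using emeasure_ratio_slab[OF mn \<kappa>, of \<alpha> "\<alpha> + \<epsilon>"] \<epsilon> by (simp add: a_def)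
    also have "a * \<epsilon> \<le> (\<bar>a\<bar> + 1) * \<epsilon>"
      using \<epsilon> by (intro mult_right_mono) auto
    then have "ennreal (a * \<epsilon>) \<le> ennreal e"
      using e by (intro ennreal_leI) (auto simp: \<epsilon>_def split: if_splits)
    finally show "emeasure surface_measure ?L \<le> 0 + ennreal e"
      by simp
  qed
  then show ?thesis
    using L by auto
qed

section \<open>Active regions and the tracing map\<close>

text \<open>A Borel replacement for the tracing map of \<open>m i\<close>: it fixes the parameter
  \<open>b i\<close>, whereas the tracing map allows any positive parameter.\<close>

definition active_region ::
    "real \<Rightarrow> (real^3) set \<Rightarrow> nat \<Rightarrow> (nat \<Rightarrow> real^3) \<Rightarrow> nat \<Rightarrow> (nat \<Rightarrow> real) \<Rightarrow> (real^3) set" where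
  "active_region \<kappa> \<Omega> N m i b =
     {x \<in> closure \<Omega>. \<forall>r \<in> {1..N}.
        ellipsoid_radius \<kappa> (m i) (b i) x \<le> ellipsoid_radius \<kappa> (m r) (b r) x}"

lemma active_region_borel: "active_region \<kappa> \<Omega> N m i b \<in> sets borel"
proof -
  have "active_region \<kappa> \<Omega> N m i b = closure \<Omega> \<inter> {x \<in> space borel. \<forall>r \<in> {1..N}.
      b i / (1 - \<kappa> * (m i \<bullet> x)) \<le> b r / (1 - \<kappa> * (m r \<bullet> x))}"
    by (auto simp: active_region_def ellipsoid_radius_def)
  also have "\<dots> \<in> sets borel"
    by (intro sets.Int[OF borel_closed[OF closed_closure]]) measurable
  finally show ?thesis .
qed

text \<open>The standing hypotheses in the form the estimates use: the target domain survives only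
  through the axes \<open>m j\<close>, and the infimum condition becomes pointwise.\<close>

locale refractor_directions =
  fixes \<kappa> :: real and \<Omega> :: "(real^3) set" and N :: nat and m :: "nat \<Rightarrow> real^3"
  assumes \<kappa>: "0 < \<kappa>" "\<kappa> < 1"
    and closure_sphere: "closure \<Omega> \<subseteq> sphere 0 1"
    and norm_m: "j \<in> {1..N} \<Longrightarrow> norm (m j) = 1"
    and aperture: "j \<in> {1..N} \<Longrightarrow> x \<in> closure \<Omega> \<Longrightarrow> \<kappa> \<le> m j \<bullet> x"
    and inj: "inj_on m {1..N}"
begin

abbreviation den :: "nat \<Rightarrow> real^3 \<Rightarrow> real" where
  "den j x \<equiv> 1 - \<kappa> * (m j \<bullet> x)"

lemma den_pos: "j \<in> {1..N} \<Longrightarrow> x \<in> closure \<Omega> \<Longrightarrow> 0 < den j x"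
  using norm_diff_inner_pos[OF norm_m \<kappa>, of j x] closure_sphere by fastforce

text \<open>On the active region the ellipsoid with parameter \<open>b i\<close> attains the
  minimum, and it lies above the minimum everywhere.\<close>

lemma active_region_subset_tracing_map:
  assumes "i \<in> {1..N}" "0 < b i"
  shows "active_region \<kappa> \<Omega> N m i b \<subseteq> tracing_map \<kappa> \<Omega> (min_refractor \<kappa> N m b) {m i}"
proof
  fix x assume x: "x \<in> active_region \<kappa> \<Omega> N m i b"
  have "min_refractor \<kappa> N m b x = ellipsoid_radius \<kappa> (m i) (b i) x"
    unfolding min_refractor_def
    using x assms by (intro Min_eqI) (auto simp: active_region_def)
  moreover have "min_refractor \<kappa> N m b y \<le> ellipsoid_radius \<kappa> (m i) (b i) y" for y
    unfolding min_refractor_def using assms by (intro Min_le) auto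
  ultimately show "x \<in> tracing_map \<kappa> \<Omega> (min_refractor \<kappa> N m b) {m i}"
    using x assms(2) by (auto simp: tracing_map_def ellipsoid_supports_def active_region_def)
qed

text \<open>
  A supporting ellipsoid with axis \<open>m i\<close> need not have parameter \<open>b i\<close>, but its parameter \<open>B\<close> is the
  same at all points, so contact outside the active region takes place on finitely many level
  sets of ratios \<open>den i x / den r x\<close>.
\<close>

lemma tracing_map_diff_active_region_null:
  assumes i: "i \<in> {1..N}" and b: "\<forall>j \<in> {1..N}. 0 < b j"
  shows "tracing_map \<kappa> \<Omega> (min_refractor \<kappa> N m b) {m i} - active_region \<kappa> \<Omega> N m i b
    \<in> null_sets surface_measure" (is "?T - ?A \<in> _")
proof (cases "?T = {}")
  case True
  then show ?thesis by simp
next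
  case False
  let ?\<rho> = "min_refractor \<kappa> N m b"
  let ?e = "ellipsoid_radius \<kappa> (m i)"
  have mono: "B \<le> B'" if "?e B x \<le> ?e B' x" "x \<in> closure \<Omega>" for B B' x
    using that den_pos[OF i] by (simp add: ellipsoid_radius_def divide_le_cancel)
  obtain x0 B where B: "x0 \<in> closure \<Omega>" "ellipsoid_supports \<kappa> \<Omega> (m i) B ?\<rho> x0"
    using False by (auto simp: tracing_map_def)
  \<comment> \<open>Of two supporting ellipsoids with the same axis, each lies above the surface at
    the contact point of the other, so their parameters coincide.\<close>
  have same: "?\<rho> x = ?e B x" if xT: "x \<in> ?T" for x
  proof -
    obtain B' where B': "x \<in> closure \<Omega>" "ellipsoid_supports \<kappa> \<Omega> (m i) B' ?\<rho> x"
      using xT by (auto simp: tracing_map_def)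
    then have "B' \<le> B" "B \<le> B'"
      using B mono[of B' x B] mono[of B x0 B'] by (auto simp: ellipsoid_supports_def)
    then show ?thesis
      using B' by (simp add: ellipsoid_supports_def)
  qed
  let ?L = "\<lambda>r. {x \<in> sphere 0 1. \<kappa> \<le> m i \<bullet> x \<and> \<kappa> \<le> m r \<bullet> x \<and> den i x / den r x = B / b r}"
  have "?T - ?A \<subseteq> (\<Union>r\<in>{1..N} - {i}. ?L r)"
  proof
    fix x assume x: "x \<in> ?T - ?A"
    then have xc: "x \<in> closure \<Omega>"
      by (auto simp: tracing_map_def)
    have "?\<rho> x \<in> (\<lambda>r. ellipsoid_radius \<kappa> (m r) (b r) x) ` {1..N}"
      unfolding min_refractor_def using i by (intro Min_in) auto
    then obtain r where r: "r \<in> {1..N}" "?\<rho> x = ellipsoid_radius \<kappa> (m r) (b r) x"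
      by auto
    have "?\<rho> x \<le> ellipsoid_radius \<kappa> (m j) (b j) x" if "j \<in> {1..N}" for j
      unfolding min_refractor_def using that by (intro Min_le) auto
    \<comment> \<open>If \<open>r = i\<close> attained the minimum at \<open>x\<close>, then
      \<open>x\<close> would be in the active region.\<close>
    then have "r \<noteq> i"
      using x xc r by (auto simp: active_region_def)
    moreover have "B / den i x = b r / den r x"
      using same[of x] x r by (simp add: ellipsoid_radius_def)
    moreover have "den i x \<noteq> 0" "den r x \<noteq> 0" "b r \<noteq> 0"
      using den_pos[OF i xc] den_pos[OF r(1) xc] bspec[OF b r(1)] by simp_all
    ultimately have "r \<noteq> i" "den i x / den r x = B / b r"
      by (simp_all add: frac_eq_eq mult.commute)
    then show "x \<in> (\<Union>r\<in>{1..N} - {i}. ?L r)"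
      using r(1) xc closure_sphere aperture[OF i xc] aperture[OF r(1) xc] by auto
  qed
  moreover have "?L r \<in> null_sets surface_measure" if "r \<in> {1..N} - {i}" for r
  proof -
    have "r \<in> {1..N}" "m i \<noteq> m r"
      using that i by (auto simp: inj_on_eq_iff[OF inj])
    then show ?thesis
      using ratio_level_null[OF norm_m[OF i] norm_m[of r]] \<kappa> by blast
  qed
  then have "(\<Union>r\<in>{1..N} - {i}. ?L r) \<in> null_sets surface_measure"
    by (intro null_sets.finite_UN) auto
  \<comment> \<open>Only inclusion in a null set has been shown; completeness of
    \<open>surface_measure\<close> also yields measurability of the difference.\<close>
  ultimately show ?thesis
    unfolding surface_measure_def by (rule null_sets_completion_subset)
qed

lemma refractor_measure_eq_active_region:
  assumes i: "i \<in> {1..N}" and b: "\<forall>j \<in> {1..N}. 0 < b j"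
    and g: "set_integrable surface_measure (closure \<Omega>) g"
  shows "refractor_measure \<kappa> \<Omega> g (min_refractor \<kappa> N m b) {m i}
    = (LINT x : active_region \<kappa> \<Omega> N m i b | surface_measure. g x)"
proof -
  let ?T = "tracing_map \<kappa> \<Omega> (min_refractor \<kappa> N m b) {m i}" and ?A = "active_region \<kappa> \<Omega> N m i b"
  have sub: "?A \<subseteq> ?T"
    using active_region_subset_tracing_map i b by blast
  have null: "?T - ?A \<in> null_sets surface_measure"
    using tracing_map_diff_active_region_null[OF i b] .
  have A: "?A \<in> sets surface_measure"
    using active_region_borel by (simp add: surface_measure_def)
  have "?T = ?A \<union> (?T - ?A)"
    using sub by auto
  \<comment> \<open>Measurability of the tracing map is obtained here, as a Borel set together with
    a null set.\<close>
  also have "\<dots> \<in> sets surface_measure"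
    using A null by blast
  finally have "set_integrable surface_measure ?T g"
    by (rule set_integrable_subset[OF g]) (auto simp: tracing_map_def)
  moreover have "set_integrable surface_measure ?A g"
    by (rule set_integrable_subset[OF g A]) (auto simp: active_region_def)
  moreover have "AE x in surface_measure. x \<in> ?A \<longleftrightarrow> x \<in> ?T"
    using AE_not_in[OF null] by eventually_elim (use sub in auto)
  ultimately show ?thesis
    unfolding refractor_measure_def
    by (intro set_integral_cong_set) (auto simp: set_integrable_def set_borel_measurable_def)
qed

section \<open>Growth of the active region when one parameter decreases\<close>

lemma slab_term_nonneg:
  assumes i: "i \<in> {1..N}" and b: "\<forall>j \<in> {1..N}. 0 < b j" and t: "t < 0" and r: "r \<in> {1..N} - {i}"
  shows "0 \<le> slab_constant \<kappa> (m i \<bullet> m r) / b r * (- t)"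
proof -
  have "\<bar>m i \<bullet> m r\<bar> \<le> 1"
    using Cauchy_Schwarz_ineq2[of "m i" "m r"] norm_m i r by simp
  then have "0 \<le> slab_constant \<kappa> (m i \<bullet> m r)"
    using \<kappa> by (simp add: slab_constant_def)
  then show ?thesis
    using b r t by (intro mult_nonneg_nonneg divide_nonneg_nonneg) (auto simp: less_imp_le)
qed

text \<open>At a new point some ellipsoid \<open>r\<close> was strictly below the
  \<open>i\<close>-th one before the decrease and is no longer so after it. The two inequalities
  place the point in a slab of width \<open>- t / b r\<close>.\<close>

lemma emeasure_active_region_growth:
  assumes i: "i \<in> {1..N}" and b: "\<forall>j \<in> {1..N}. 0 < b j" and t: "t < 0"
  shows "emeasure surface_measure
      (active_region \<kappa> \<Omega> N m i (b(i := b i + t)) - active_region \<kappa> \<Omega> N m i b)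
    \<le> ennreal (\<Sum>r\<in>{1..N} - {i}. slab_constant \<kappa> (m i \<bullet> m r) / b r * (- t))"
proof -
  let ?A = "active_region \<kappa> \<Omega> N m i b" and ?A' = "active_region \<kappa> \<Omega> N m i (b(i := b i + t))"
  let ?S = "\<lambda>r. ratio_slab \<kappa> (m i) (m r) ((b i + t) / b r) (b i / b r)"
  have S: "?S r \<in> sets surface_measure" for r
    using ratio_slab_borel by (simp add: surface_measure_def)
  have sub: "?A' - ?A \<subseteq> (\<Union>r\<in>{1..N} - {i}. ?S r)"
  proof
    fix x assume x: "x \<in> ?A' - ?A"
    then have xc: "x \<in> closure \<Omega>"
      by (auto simp: active_region_def)
    from x obtain r where r: "r \<in> {1..N}"
      "\<not> ellipsoid_radius \<kappa> (m i) (b i) x \<le> ellipsoid_radius \<kappa> (m r) (b r) x"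
      by (auto simp: active_region_def)
    then have ri: "r \<noteq> i"
      by auto
    \<comment> \<open>Since \<open>r \<noteq> i\<close>, the updated parameter vector still has the
      value \<open>b r\<close> at \<open>r\<close>.\<close>
    have "(b i + t) / den i x \<le> b r / den r x"
      using x r(1) ri by (auto simp: active_region_def ellipsoid_radius_def dest!: bspec[of _ _ r])
    moreover have "b r / den r x < b i / den i x"
      using r(2) by (simp add: ellipsoid_radius_def)
    moreover have "0 < b r"
      using b r(1) by simp
    ultimately have "(b i + t) / b r \<le> den i x / den r x" "den i x / den r x < b i / b r"
      using den_pos[OF i xc] den_pos[OF r(1) xc] by (simp_all add: divide_simps mult_ac)
    then show "x \<in> (\<Union>r\<in>{1..N} - {i}. ?S r)"
      using ri r(1) xc closure_sphere aperture[OF i xc] aperture[OF r(1) xc]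
      by (auto simp: ratio_slab_def)
  qed
  have bound: "emeasure surface_measure (?S r)
      \<le> ennreal (slab_constant \<kappa> (m i \<bullet> m r) / b r * (- t))" if r: "r \<in> {1..N} - {i}" for r
  proof -
    have "0 < b r"
      using b r by simp
    then have less: "(b i + t) / b r < b i / b r"
      using t by (intro divide_strict_right_mono) auto
    have "m i \<noteq> m r"
      using r i by (auto simp: inj_on_eq_iff[OF inj])
    moreover have "norm (m r) = 1"
      using r norm_m by blast
    ultimately have "emeasure surface_measure (?S r)
        \<le> ennreal (slab_constant \<kappa> (m i \<bullet> m r) * (b i / b r - (b i + t) / b r))"
      using norm_m[OF i] \<kappa> less by (intro emeasure_ratio_slab)
    also have "b i / b r - (b i + t) / b r = - t / b r"
      by (simp add: add_divide_distrib)
    finally show ?thesis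
      by simp
  qed
  have "emeasure surface_measure (?A' - ?A) \<le> emeasure surface_measure (\<Union>r\<in>{1..N} - {i}. ?S r)"
    using sub S by (intro emeasure_mono) auto
  also have "\<dots> \<le> (\<Sum>r\<in>{1..N} - {i}. emeasure surface_measure (?S r))"
    using S by (intro emeasure_subadditive_finite) auto
  also have "\<dots> \<le> (\<Sum>r\<in>{1..N} - {i}. ennreal (slab_constant \<kappa> (m i \<bullet> m r) / b r * (- t)))"
    using bound by (rule sum_mono)
  also have "\<dots> = ennreal (\<Sum>r\<in>{1..N} - {i}. slab_constant \<kappa> (m i \<bullet> m r) / b r * (- t))"
    using slab_term_nonneg[OF i b t] by (rule sum_ennreal)
  finally show ?thesis .
qed

end

section \<open>From measure bounds to the increment of the refractor measure\<close>

text \<open>The bound on \<open>g\<close> is almost everywhere because it will be a supremum over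
  \<open>\<Omega>\<close>, while \<open>D\<close> may meet the boundary of \<open>\<Omega>\<close>.
  Finiteness of the measure of \<open>D\<close> makes the constant integrable.\<close>

lemma set_integral_le_measure_mult:
  fixes g :: "'a \<Rightarrow> real"
  assumes D: "D \<in> sets M" and g: "set_integrable M D g" and "AE x \<in> D in M. g x \<le> K" "0 \<le> K"
    and "emeasure M D \<le> ennreal s" "0 \<le> s"
  shows "(LINT x : D | M. g x) \<le> K * s"
proof -
  have fin: "emeasure M D < \<infinity>"
    using assms(5) by (simp add: le_less_trans)
  have "(LINT x : D | M. g x) \<le> (LINT x : D | M. K)"
    using assms(3) D fin g by (intro set_integral_mono_AE) (auto simp: set_integrable_def)
  also have "\<dots> = K * measure M D"
    using D fin by (subst set_integral_const) auto
  also have "\<dots> \<le> K * s"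
    using assms(4-6) by (intro mult_left_mono) (auto simp: measure_def enn2real_leI)
  finally show ?thesis .
qed

text \<open>Passing to active regions, which are nested, turns the increment into the integral of
  \<open>g\<close> over their difference. Its sign is that of \<open>g\<close>, and its size is
  controlled by the slab bounds.\<close>

lemma refractor_measure_increment:
  fixes b :: "nat \<Rightarrow> real"
  assumes \<kappa>: "0 < \<kappa>" "\<kappa> < 1" and dom: "sphere_domain \<Omega>" "sphere_domain \<Omega>'"
    and INF: "(INF (m, x) \<in> closure \<Omega>' \<times> closure \<Omega>. m \<bullet> x) \<ge> \<kappa>"
    and frontier: "(top_of_set (sphere 0 1)) frontier_of \<Omega> \<in> null_sets surface_measure"
    and g: "set_integrable surface_measure (closure \<Omega>) g" "\<forall>x \<in> closure \<Omega>. 0 \<le> g x"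
      "bdd_above (g ` \<Omega>)"
    and m: "\<forall>j \<in> {1..N}. m j \<in> closure \<Omega>'" "inj_on m {1..N}"
    and i: "i \<in> {1..N}" and b: "\<forall>j \<in> {1..N}. 0 < b j" and t: "- b i < t" "t < 0"
  shows "0 \<le> refractor_measure \<kappa> \<Omega> g (min_refractor \<kappa> N m (b(i := b i + t))) {m i}
        - refractor_measure \<kappa> \<Omega> g (min_refractor \<kappa> N m b) {m i} \<and>
      refractor_measure \<kappa> \<Omega> g (min_refractor \<kappa> N m (b(i := b i + t))) {m i}
        - refractor_measure \<kappa> \<Omega> g (min_refractor \<kappa> N m b) {m i}
      \<le> (SUP x \<in> \<Omega>. g x) * (\<Sum>r \<in> {1..N} - {i}. slab_constant \<kappa> (m i \<bullet> m r) / b r * (- t))"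
proof -
  have sphere: "closure \<Omega> \<subseteq> sphere 0 1" "closure \<Omega>' \<subseteq> sphere 0 1"
    using dom by (metis sphere_domain_def openin_imp_subset closed_sphere closure_minimal)+
  \<comment> \<open>An infimum of reals is a lower bound only for a set bounded below;
    Cauchy-Schwarz on the sphere gives \<open>-1\<close>.\<close>
  have bdd: "bdd_below ((\<lambda>(m, x). m \<bullet> x) ` (closure \<Omega>' \<times> closure \<Omega>))"
  proof (rule bdd_belowI2[of _ "-1"], clarify)
    fix u x assume "u \<in> closure \<Omega>'" "x \<in> closure \<Omega>"
    then show "-1 \<le> u \<bullet> x"
      using sphere Cauchy_Schwarz_ineq2[of u x] by (force simp: abs_le_iff)
  qed
  have aperture: "\<kappa> \<le> u \<bullet> x" if "u \<in> closure \<Omega>'" "x \<in> closure \<Omega>" for u x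
    using INF cINF_lower[OF bdd, of "(u, x)"] that by simp
  have "norm (m j) = 1" if "j \<in> {1..N}" for j
    using m(1) sphere(2) that by (metis mem_sphere_0 subsetD)
  then interpret refractor_directions \<kappa> \<Omega> N m
    using \<kappa> sphere m aperture by unfold_locales auto
  define b' where "b' = b(i := b i + t)"
  have b': "\<forall>j \<in> {1..N}. 0 < b' j"
    using b t by (auto simp: b'_def)
  let ?A = "active_region \<kappa> \<Omega> N m i b" and ?A' = "active_region \<kappa> \<Omega> N m i b'"
  let ?s = "\<Sum>r \<in> {1..N} - {i}. slab_constant \<kappa> (m i \<bullet> m r) / b r * (- t)"
  \<comment> \<open>Lowering \<open>b i\<close> lowers the \<open>i\<close>-th radius and changes no
    other, so it stays minimal wherever it was.\<close>
  have AA': "?A \<subseteq> ?A'"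
  proof
    fix x assume x: "x \<in> ?A"
    then have "0 < den i x"
      using den_pos[OF i] by (auto simp: active_region_def)
    then have "ellipsoid_radius \<kappa> (m i) (b i + t) x \<le> ellipsoid_radius \<kappa> (m i) (b i) x"
      using t by (simp add: ellipsoid_radius_def divide_right_mono)
    then show "x \<in> ?A'"
      using x by (fastforce simp: active_region_def b'_def)
  qed
  have sets: "?A \<in> sets surface_measure" "?A' - ?A \<in> sets surface_measure"
    using active_region_borel by (auto simp: surface_measure_def)
  have int: "set_integrable surface_measure ?A g" "set_integrable surface_measure (?A' - ?A) g"
    using sets by (auto intro!: set_integrable_subset[OF g(1)] simp: active_region_def)
  have "(LINT x : ?A' | surface_measure. g x) = (LINT x : ?A \<union> (?A' - ?A) | surface_measure. g x)"
    using AA' by (simp add: Un_absorb1)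
  also have "\<dots> = (LINT x : ?A | surface_measure. g x) + (LINT x : ?A' - ?A | surface_measure. g x)"
    using int by (intro set_integral_Un) auto
  finally have diff: "refractor_measure \<kappa> \<Omega> g (min_refractor \<kappa> N m b') {m i}
      - refractor_measure \<kappa> \<Omega> g (min_refractor \<kappa> N m b) {m i}
      = (LINT x : ?A' - ?A | surface_measure. g x)"
    using refractor_measure_eq_active_region[OF i b g(1)]
      refractor_measure_eq_active_region[OF i b' g(1)] by simp
  have "0 \<le> (LINT x : ?A' - ?A | surface_measure. g x)"
    unfolding set_lebesgue_integral_def
    using g(2) by (intro integral_nonneg_AE) (auto simp: active_region_def indicator_def)
  moreover have "(LINT x : ?A' - ?A | surface_measure. g x) \<le> (SUP x \<in> \<Omega>. g x) * ?s"
  proof (rule set_integral_le_measure_mult[OF sets(2) int(2)])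
    \<comment> \<open>As \<open>closure \<Omega>\<close> lies in the sphere, the relative frontier
      of \<open>\<Omega>\<close> is \<open>closure \<Omega> - \<Omega>\<close>. It is null, so
      almost every point of the closure lies in \<open>\<Omega>\<close>, where the supremum bounds
      \<open>g\<close>.\<close>
    have "openin (top_of_set (sphere 0 1)) \<Omega>"
      using dom by (simp add: sphere_domain_def)
    moreover from this have "sphere 0 1 \<inter> \<Omega> = \<Omega>"
      using openin_imp_subset by blast
    ultimately have "top_of_set (sphere 0 1) frontier_of \<Omega> = closure \<Omega> - \<Omega>"
      using sphere(1) by (simp add: frontier_of_openin closure_of_subtopology Int_absorb1)
    with frontier have "closure \<Omega> - \<Omega> \<in> null_sets surface_measure"
      by simp
    then show "AE x \<in> ?A' - ?A in surface_measure. g x \<le> (SUP x \<in> \<Omega>. g x)"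
      by (rule AE_not_in[THEN eventually_mono])
        (auto simp: active_region_def intro: cSUP_upper g(3))
    obtain x where "x \<in> \<Omega>"
      using dom by (auto simp: sphere_domain_def)
    then show "0 \<le> (SUP x \<in> \<Omega>. g x)"
      using g(2) closure_subset[of \<Omega>] by (intro cSUP_upper2[OF g(3)]) auto
    show "emeasure surface_measure (?A' - ?A) \<le> ennreal ?s"
      using emeasure_active_region_growth[OF i b t(2)] by (simp add: b'_def)
    show "0 \<le> ?s"
      using slab_term_nonneg[OF i b t(2)] by (intro sum_nonneg)
  qed
  ultimately show ?thesis
    by (simp add: diff flip: b'_def)
qed

text \<open>The witness \<open>slab_constant\<close> is chosen before the domains, the density and
  the axes, so it depends on \<open>\<kappa>\<close> and the cosine \<open>m i \<bullet> m r\<close>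
  alone.\<close>

theorem proposition5p1:
  shows "\<exists>C :: real \<Rightarrow> real \<Rightarrow> real.
    \<forall>(\<kappa> :: real) (\<Omega> :: (real^3) set) (\<Omega>' :: (real^3) set) (g :: real^3 \<Rightarrow> real)
     (N :: nat) (m :: nat \<Rightarrow> real^3).
      0 < \<kappa> \<and> \<kappa> < 1 \<and>
      sphere_domain \<Omega> \<and> sphere_domain \<Omega>' \<and>
      (INF (m, x) \<in> closure \<Omega>' \<times> closure \<Omega>. m \<bullet> x) \<ge> \<kappa> \<and>
      (top_of_set (sphere 0 1)) frontier_of \<Omega> \<in> null_sets surface_measure \<and>
      set_integrable surface_measure (closure \<Omega>) g \<and>
      (\<forall>x \<in> closure \<Omega>. 0 \<le> g x) \<and>
      bdd_above (g ` \<Omega>) \<and>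
      2 \<le> N \<and> (\<forall>j \<in> {1..N}. m j \<in> closure \<Omega>') \<and> inj_on m {1..N}
      \<longrightarrow>
      (let G = (\<lambda>i b. refractor_measure \<kappa> \<Omega> g (min_refractor \<kappa> N m b) {m i}) in
       \<forall>i \<in> {1..N}. \<forall>b :: nat \<Rightarrow> real. (\<forall>j \<in> {1..N}. 0 < b j) \<longrightarrow>
         (\<forall>t. - b i < t \<and> t < 0 \<longrightarrow>
            0 \<le> G i (b(i := b i + t)) - G i b \<and>
            G i (b(i := b i + t)) - G i b
              \<le> (SUP x \<in> \<Omega>. g x) * (\<Sum>r \<in> {1..N} - {i}. C \<kappa> (m i \<bullet> m r) / b r * (- t))))"
proof (rule exI[of _ slab_constant], intro allI impI)
  fix \<kappa> :: real and \<Omega> \<Omega>' :: "(real^3) set" and g :: "real^3 \<Rightarrow> real"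
    and N :: nat and m :: "nat \<Rightarrow> real^3"
  assume H: "0 < \<kappa> \<and> \<kappa> < 1 \<and>
      sphere_domain \<Omega> \<and> sphere_domain \<Omega>' \<and>
      (INF (m, x) \<in> closure \<Omega>' \<times> closure \<Omega>. m \<bullet> x) \<ge> \<kappa> \<and>
      (top_of_set (sphere 0 1)) frontier_of \<Omega> \<in> null_sets surface_measure \<and>
      set_integrable surface_measure (closure \<Omega>) g \<and>
      (\<forall>x \<in> closure \<Omega>. 0 \<le> g x) \<and>
      bdd_above (g ` \<Omega>) \<and>
      2 \<le> N \<and> (\<forall>j \<in> {1..N}. m j \<in> closure \<Omega>') \<and> inj_on m {1..N}"
  show "let G = (\<lambda>i b. refractor_measure \<kappa> \<Omega> g (min_refractor \<kappa> N m b) {m i}) in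
       \<forall>i \<in> {1..N}. \<forall>b :: nat \<Rightarrow> real. (\<forall>j \<in> {1..N}. 0 < b j) \<longrightarrow>
         (\<forall>t. - b i < t \<and> t < 0 \<longrightarrow>
            0 \<le> G i (b(i := b i + t)) - G i b \<and>
            G i (b(i := b i + t)) - G i b
              \<le> (SUP x \<in> \<Omega>. g x) * (\<Sum>r \<in> {1..N} - {i}. slab_constant \<kappa> (m i \<bullet> m r) / b r * (- t)))"
    unfolding Let_def
  proof (intro ballI allI impI)
    fix i t and b :: "nat \<Rightarrow> real"
    assume "i \<in> {1..N}" "\<forall>j \<in> {1..N}. 0 < b j" "- b i < t \<and> t < 0"
    with H show "0 \<le> refractor_measure \<kappa> \<Omega> g (min_refractor \<kappa> N m (b(i := b i + t))) {m i}
          - refractor_measure \<kappa> \<Omega> g (min_refractor \<kappa> N m b) {m i} \<and>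
        refractor_measure \<kappa> \<Omega> g (min_refractor \<kappa> N m (b(i := b i + t))) {m i}
          - refractor_measure \<kappa> \<Omega> g (min_refractor \<kappa> N m b) {m i}
        \<le> (SUP x \<in> \<Omega>. g x) * (\<Sum>r \<in> {1..N} - {i}. slab_constant \<kappa> (m i \<bullet> m r) / b r * (- t))"
      by (elim conjE) (rule refractor_measure_increment[of \<kappa> \<Omega> \<Omega>' g N m i b t]; assumption)
  qed
qed

end
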